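(* Let $B$ be a transcendence basis of $\mathbb{R}/\mathbb{Q}$ containing $\pi$, let $k=\mathbb{Q}(B\setminus\{\pi\})$, and let $X_k$ be the set of real numbers that are not algebraic over $k$. For every $T\in X_k$, the elements $0$ and $i$ of $\mathbb{C}$ have no least upper bound in the order on $\mathbb{C}$ defined by $P_T$, that is, the order $x\preceq y\iff y-x\in P_T$.
   Context: $\mathbb{A}=\overline{\mathbb{Q}}\cap\mathbb{R}$ is the field of real algebraic numbers with its usual order, and $\mathbb{A}_{>0}$ is the set of its positive elements. For $T\in X_k$ put $t_T=T^{-1}$, let $\mathcal{O}_T$ be the integral closure in $\mathbb{C}$ of the local ring $k[t_T]_{(t_T)}=\{f(t_T)/g(t_T): f,g\in k[X],\ g(0)\ne0\}$ (the localization of $k[t_T]$ at the maximal ideal $(t_T)$), and define $$P_T=\{0\}\cup\bigcup_{n\in\mathbb{Z}}t_T^{-n}(\mathbb{A}_{>0}+t_T\mathcal{O}_T)\subseteq\mathbb{C}.$$ The set $P_T$ is a positive cone ($P_T+P_T\subseteq P_T$, $P_TP_T\subseteq P_T$, $P_T\cap(-P_T)=\{0\}$), so $\preceq$ is a partial order compatible with the ring operations. *)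

theory Defs
  imports
    "HOL-Analysis.Analysis"
    "HOL-Computational_Algebra.Computational_Algebra"
    "HOL-Library.Poly_Mapping"
    "HOL-Algebra.Order"
begin

definition is_subfield :: "'a::field set \<Rightarrow> bool" where
  "is_subfield K \<longleftrightarrow>
     1 \<in> K \<and> (\<forall>x\<in>K. \<forall>y\<in>K. x - y \<in> K \<and> x * y \<in> K) \<and> (\<forall>x\<in>K. inverse x \<in> K)"

definition adjoin :: "'a::field set \<Rightarrow> 'a set \<Rightarrow> 'a set" where
  "adjoin K S = is_subfield hull (K \<union> S)"

definition algebraic_over :: "'a::field set \<Rightarrow> 'a \<Rightarrow> bool" where
  "algebraic_over K x \<longleftrightarrow> (\<exists>p. (\<forall>i. coeff p i \<in> K) \<and> p \<noteq> 0 \<and> poly p x = 0)"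

text \<open>
  A multivariate polynomial is a finitely supported map from monomials to coefficients, and
  a monomial a finitely supported map from variables to exponents. The variables are
  field elements, each of which is evaluated at itself.
\<close>

definition self_eval :: "(('a::field \<Rightarrow>\<^sub>0 nat) \<Rightarrow>\<^sub>0 'a) \<Rightarrow> 'a" where
  "self_eval p =
     (\<Sum>m\<in>Poly_Mapping.keys p. Poly_Mapping.lookup p m *
        (\<Prod>x\<in>Poly_Mapping.keys m. x ^ Poly_Mapping.lookup m x))"

definition algebraically_independent :: "'a::field set \<Rightarrow> 'a set \<Rightarrow> bool" where
  "algebraically_independent K B \<longleftrightarrow>
     (\<forall>p. (\<forall>m. Poly_Mapping.lookup p m \<in> K) \<and>
          (\<forall>m\<in>Poly_Mapping.keys p. Poly_Mapping.keys m \<subseteq> B) \<and>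
          self_eval p = 0 \<longrightarrow> p = 0)"

text \<open>The extension field is the whole type.\<close>

definition transcendence_basis :: "'a::field set \<Rightarrow> 'a set \<Rightarrow> bool" where
  "transcendence_basis K B \<longleftrightarrow>
     algebraically_independent K B \<and> (\<forall>x. algebraic_over (adjoin K B) x)"

definition transcendentals :: "real set \<Rightarrow> real set" where
  "transcendentals k = {T. \<not> algebraic_over k T}"

text \<open>The localization of \<open>k[t]\<close> at the ideal \<open>(t)\<close>, for \<open>t\<close> transcendental over \<open>k\<close>.\<close>

definition local_ring :: "'a::field set \<Rightarrow> 'a \<Rightarrow> 'a set" where
  "local_ring k t =
     {poly f t / poly g t | f g.
        (\<forall>i. coeff f i \<in> k) \<and> (\<forall>i. coeff g i \<in> k) \<and> poly g 0 \<noteq> 0}"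

definition integral_closure :: "'a::field set \<Rightarrow> 'a set" where
  "integral_closure R =
     {x. \<exists>p. (\<forall>i. coeff p i \<in> R) \<and> lead_coeff p = 1 \<and> poly p x = 0}"

definition O_ring :: "real set \<Rightarrow> real \<Rightarrow> complex set" where
  "O_ring k T = integral_closure (complex_of_real ` local_ring k (inverse T))"

definition pos_cone :: "real set \<Rightarrow> real \<Rightarrow> complex set" where
  "pos_cone k T =
     (let t = complex_of_real (inverse T) in
      {0} \<union> (\<Union>n::int.
        {t powi (- n) * (complex_of_real a + t * y) | a y.
           algebraic a \<and> a > 0 \<and> y \<in> O_ring k T}))"

definition cone_order :: "'a::ab_group_add set \<Rightarrow> 'a gorder" where
  "cone_order P = \<lparr>carrier = UNIV, eq = (=), le = (\<lambda>x y. y - x \<in> P)\<rparr>"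

end

theory Submission
  imports Defs
begin

text \<open>
  Write \<open>t = 1/T\<close> and \<open>O\<close> for the ring \<open>O_ring k T\<close>. Every nonzero element of the cone has the form
  \<open>t\<^sup>n (a + t y)\<close> with \<open>a\<close> real algebraic and positive and \<open>y \<in> O\<close>. The order is decided by the leading
  coefficient \<open>a\<close>, which is well defined (\<open>leading_coefficient_unique\<close>) because \<open>O\<close> is a ring that
  contains all algebraic numbers but not \<open>1/t\<close>: a nonzero algebraic number is then a unit of \<open>O\<close>
  and cannot lie in \<open>t O\<close>.

  Let \<open>u\<close> be an upper bound of \<open>0\<close> and \<open>\<i>\<close>. If \<open>u\<close> were \<open>b + t y\<close> with \<open>b\<close> real algebraic (possibly
  \<open>0\<close>), then \<open>u - \<i>\<close> would have the leading coefficient \<open>b - \<i>\<close>, which is not real. So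
  \<open>u = t\<^sup>n (a + t y)\<close> with \<open>n < 0\<close> and \<open>a > 0\<close>. But \<open>w = a / (2 t)\<close> is an upper bound as well, as
  \<open>\<i>\<close> is of lower order than \<open>1/t\<close>, and \<open>w - u\<close> has the leading coefficient \<open>- a / 2\<close> or \<open>- a\<close>.
  So \<open>u\<close> is not below \<open>w\<close>, and hence no upper bound is least.

  The algebra behind this is that integral closures are rings (\<open>is_subring_integral_closure\<close>). It
  also yields that algebraic numbers are closed under differences and products: they are the integral
  closure of \<open>\<rat>\<close>. The proof avoids determinants and finitely generated modules. A nonzero element
  \<open>x\<close> of a field is integral over \<open>R\<close> if and only if \<open>x \<in> R[1/x]\<close>. If it is not, Zorn's
  lemma gives a subring \<open>A\<close> that contains \<open>R[1/x]\<close> and is maximal among those without \<open>x\<close>. Such an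
  \<open>A\<close> is integrally closed (\<open>maximal_avoiding_integrally_closed\<close>), so it contains everything integral
  over \<open>R\<close>. Hence the integral closure of \<open>R\<close> is an intersection of subrings. The same criterion,
  applied to \<open>x = 1/t\<close>, shows that \<open>1/t\<close> is not integral over the local ring, which contains \<open>t\<close>
  but not \<open>1/t\<close>.
\<close>

section \<open>Subrings and polynomials over them\<close>

definition is_subring :: "'a::comm_ring_1 set \<Rightarrow> bool" where
  "is_subring R \<longleftrightarrow> 1 \<in> R \<and> (\<forall>x\<in>R. \<forall>y\<in>R. x - y \<in> R \<and> x * y \<in> R)"

definition polys_over :: "'a::comm_ring_1 set \<Rightarrow> 'a poly set" where
  "polys_over R = {p. \<forall>i. coeff p i \<in> R}"

text \<open>The ring usually written \<open>R[x]\<close>, for an element \<open>x\<close> of an overring of \<open>R\<close>.\<close>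

definition poly_values :: "'a::comm_ring_1 set \<Rightarrow> 'a \<Rightarrow> 'a set" where
  "poly_values R x = (\<lambda>p. poly p x) ` polys_over R"

context
  fixes R :: "'a::comm_ring_1 set"
  assumes R: "is_subring R"
begin

lemma subring_one: "1 \<in> R"
  and subring_diff: "x \<in> R \<Longrightarrow> y \<in> R \<Longrightarrow> x - y \<in> R"
  and subring_mult: "x \<in> R \<Longrightarrow> y \<in> R \<Longrightarrow> x * y \<in> R"
  using R by (auto simp: is_subring_def)

lemma subring_zero: "0 \<in> R"
  using subring_diff[OF subring_one subring_one] by simp

lemma subring_minus: "x \<in> R \<Longrightarrow> - x \<in> R"
  using subring_diff[OF subring_zero] by simp

lemma subring_add: "x \<in> R \<Longrightarrow> y \<in> R \<Longrightarrow> x + y \<in> R"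
  using subring_diff[OF _ subring_minus] by fastforce

lemma subring_power: "x \<in> R \<Longrightarrow> x ^ n \<in> R"
  by (induction n) (auto intro: subring_one subring_mult)

lemma subring_sum: "(\<And>i. i \<in> I \<Longrightarrow> f i \<in> R) \<Longrightarrow> sum f I \<in> R"
  by (induction I rule: infinite_finite_induct) (auto intro: subring_zero subring_add)

lemma polys_over_const: "a \<in> R \<Longrightarrow> [:a:] \<in> polys_over R"
  by (auto simp: polys_over_def coeff_pCons subring_zero split: nat.split)

lemma polys_over_X: "[:0, 1:] \<in> polys_over R"
  by (auto simp: polys_over_def coeff_pCons subring_zero subring_one split: nat.split)

lemma is_subring_polys_over: "is_subring (polys_over R)"
  unfolding is_subring_def
proof (intro conjI ballI)
  show "1 \<in> polys_over R"
    using polys_over_const[OF subring_one] by (simp add: one_pCons)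
  fix p q assume "p \<in> polys_over R" "q \<in> polys_over R"
  then show "p - q \<in> polys_over R" "p * q \<in> polys_over R"
    by (auto simp: polys_over_def coeff_mult intro!: subring_diff subring_sum subring_mult)
qed

lemma poly_in_subring:
  assumes "p \<in> polys_over R" "x \<in> R"
  shows "poly p x \<in> R"
  using assms by (auto simp: poly_altdef polys_over_def intro!: subring_sum subring_mult subring_power)

lemma is_subring_poly_values: "is_subring (poly_values R x)"
proof -
  note S = is_subring_polys_over
  show ?thesis
    unfolding is_subring_def poly_values_def
  proof (intro conjI ballI)
    show "1 \<in> (\<lambda>p. poly p x) ` polys_over R"
      using R S by (intro image_eqI[of _ _ 1]) (auto simp: is_subring_def)
    fix a b assume "a \<in> (\<lambda>p. poly p x) ` polys_over R" "b \<in> (\<lambda>p. poly p x) ` polys_over R"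
    then obtain p q where *: "p \<in> polys_over R" "q \<in> polys_over R" "a = poly p x" "b = poly q x"
      by blast
    show "a - b \<in> (\<lambda>p. poly p x) ` polys_over R"
      using S * by (intro image_eqI[of _ _ "p - q"]) (auto simp: is_subring_def)
    show "a * b \<in> (\<lambda>p. poly p x) ` polys_over R"
      using S * by (intro image_eqI[of _ _ "p * q"]) (auto simp: is_subring_def)
  qed
qed

lemma subset_poly_values: "R \<subseteq> poly_values R x"
proof
  fix a assume "a \<in> R"
  then show "a \<in> poly_values R x"
    unfolding poly_values_def by (intro image_eqI[of _ _ "[:a:]"]) (auto intro: polys_over_const)
qed

lemma self_in_poly_values: "x \<in> poly_values R x"
  unfolding poly_values_def by (intro image_eqI[of _ _ "[:0, 1:]"]) (auto intro: polys_over_X)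

end

lemma is_subring_image:
  assumes "is_subring R" "f 1 = 1" "\<And>x y. f (x - y) = f x - f y" "\<And>x y. f (x * y) = f x * f y"
  shows "is_subring (f ` R)"
  unfolding is_subring_def
proof (intro conjI ballI)
  show "1 \<in> f ` R"
    using assms(2) subring_one[OF assms(1)] by (metis imageI)
  fix a b assume "a \<in> f ` R" "b \<in> f ` R"
  then show "a - b \<in> f ` R" "a * b \<in> f ` R"
    by (auto simp flip: assms(3,4) intro!: imageI subring_diff[OF assms(1)] subring_mult[OF assms(1)])
qed

lemma reflect_poly_over:
  "is_subring R \<Longrightarrow> p \<in> polys_over R \<Longrightarrow> reflect_poly p \<in> polys_over R"
  by (auto simp: polys_over_def coeff_reflect_poly subring_zero)

lemma pCons_over_iff: "pCons a p \<in> polys_over R \<longleftrightarrow> a \<in> R \<and> p \<in> polys_over R"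
  by (auto simp: polys_over_def coeff_pCons split: nat.splits)

section \<open>Integral closures are rings\<close>

lemma integral_closure_altdef:
  "integral_closure R = {x. \<exists>p\<in>polys_over R. lead_coeff p = 1 \<and> poly p x = 0}"
  by (auto simp: integral_closure_def polys_over_def)

lemma integral_closure_mono: "R \<subseteq> S \<Longrightarrow> integral_closure R \<subseteq> integral_closure S"
  unfolding integral_closure_def by blast

lemma subset_integral_closure:
  assumes "is_subring R"
  shows "R \<subseteq> integral_closure R"
proof
  fix a assume "a \<in> R"
  then have "[:- a, 1:] \<in> polys_over R"
    using subring_minus[OF assms] subring_one[OF assms]
      subring_zero[OF is_subring_polys_over[OF assms]] by (simp add: pCons_over_iff)
  then show "a \<in> integral_closure R"
    unfolding integral_closure_altdef by (intro CollectI bexI[of _ "[:- a, 1:]"]) auto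
qed

text \<open>
  Multiply \<open>1 + (1/x) r(1/x) = 0\<close> by \<open>x\<close> or by a power of \<open>x\<close>: the first gives \<open>x = - r(1/x)\<close>, the
  second a monic equation for \<open>x\<close>. Reversing the coefficients exchanges the two, with leading
  coefficient \<open>1\<close> on one side and constant coefficient \<open>1\<close> on the other.
\<close>

lemma integral_iff_mem_poly_values_inverse:
  fixes x :: "'a::field"
  assumes R: "is_subring R" and x: "x \<noteq> 0"
  shows "x \<in> integral_closure R \<longleftrightarrow> x \<in> poly_values R (inverse x)"
proof
  assume "x \<in> integral_closure R"
  then obtain p where p: "p \<in> polys_over R" "lead_coeff p = 1" "poly p x = 0"
    by (auto simp: integral_closure_altdef)
  obtain r where r: "reflect_poly p = pCons 1 r"
    using p(2) by (metis coeff_0_reflect_poly coeff_pCons_0 pCons_cases)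
  have "poly (reflect_poly p) (inverse x) = 0"
    using p(3) x poly_reflect_poly_nz[of "inverse x" p] by simp
  then have "x * (1 + inverse x * poly r (inverse x)) = 0"
    by (simp add: r)
  then have "x + poly r (inverse x) = 0"
    using x by (simp add: distrib_left flip: mult.assoc)
  then have "x = poly (- r) (inverse x)"
    by (simp add: eq_neg_iff_add_eq_0)
  moreover have "- r \<in> polys_over R"
    using reflect_poly_over[OF R p(1)] r subring_minus[OF is_subring_polys_over[OF R]]
    by (simp add: pCons_over_iff)
  ultimately show "x \<in> poly_values R (inverse x)"
    unfolding poly_values_def by blast
next
  assume "x \<in> poly_values R (inverse x)"
  then obtain p where p: "p \<in> polys_over R" "x = poly p (inverse x)"
    by (auto simp: poly_values_def)
  define q where "q = pCons 1 (- p)"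
  have "q \<in> polys_over R"
    using p(1) subring_minus[OF is_subring_polys_over[OF R]] subring_one[OF R]
    by (simp add: q_def pCons_over_iff)
  moreover have "poly q (inverse x) = 0"
    using p(2) x by (simp add: q_def field_simps)
  then have "poly (reflect_poly q) x = 0"
    using x by (simp add: poly_reflect_poly_nz)
  moreover have "lead_coeff (reflect_poly q) = 1"
    by (simp add: q_def coeff_reflect_poly)
  ultimately show "x \<in> integral_closure R"
    unfolding integral_closure_altdef using reflect_poly_over[OF R] by blast
qed

lemma maximal_subring_avoiding:
  fixes w :: "'a::comm_ring_1"
  assumes "is_subring R" "w \<notin> R"
  obtains A where "is_subring A" "R \<subseteq> A" "w \<notin> A"
    "\<And>S. is_subring S \<Longrightarrow> A \<subseteq> S \<Longrightarrow> w \<notin> S \<Longrightarrow> S = A"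
proof -
  let ?F = "{S. is_subring S \<and> R \<subseteq> S \<and> w \<notin> S}"
  have "\<exists>A\<in>?F. \<forall>S\<in>?F. A \<subseteq> S \<longrightarrow> S = A"
  proof (rule subset_Zorn_nonempty)
    show "?F \<noteq> {}"
      using assms by blast
    fix C assume C: "C \<noteq> {}" "subset.chain ?F C"
    have sub: "is_subring S" "R \<subseteq> S" "w \<notin> S" if "S \<in> C" for S
      using that C(2) by (auto simp: subset_chain_def)
    have "x - y \<in> \<Union>C \<and> x * y \<in> \<Union>C" if xy: "x \<in> \<Union>C" "y \<in> \<Union>C" for x y
    proof -
      obtain S1 S2 where S12: "S1 \<in> C" "S2 \<in> C" "x \<in> S1" "y \<in> S2"
        using xy by blast
      then have "S1 \<subseteq> S2 \<or> S2 \<subseteq> S1"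
        using C(2) by (auto simp: subset_chain_def)
      then obtain S where S: "S \<in> C" "x \<in> S" "y \<in> S"
        using S12 by blast
      then show ?thesis
        using subring_diff[OF sub(1)[OF S(1)] S(2,3)] subring_mult[OF sub(1)[OF S(1)] S(2,3)] by blast
    qed
    moreover have "1 \<in> \<Union>C"
      using C(1) sub(1) subring_one by blast
    ultimately have "is_subring (\<Union>C)"
      by (simp only: is_subring_def) blast
    moreover have "R \<subseteq> \<Union>C" "w \<notin> \<Union>C"
      using C(1) sub(2,3) by blast+
    ultimately show "\<Union>C \<in> ?F"
      by blast
  qed
  then obtain A where "A \<in> ?F" "\<forall>S\<in>?F. A \<subseteq> S \<longrightarrow> S = A"
    by blast
  then show thesis
    by (intro that[of A]) auto
qed

text \<open>
  Put \<open>t = 1/w\<close>. By maximality, \<open>1 + t A\<close> consists of units of \<open>A\<close>, and an element \<open>x\<close> outside \<open>A\<close>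
  satisfies \<open>w \<in> A[x]\<close>, that is, \<open>t p(x) = 1\<close> for some \<open>p\<close> over \<open>A\<close>. Suppose that \<open>x\<close> also is a root
  of a monic \<open>q\<close> over \<open>A\<close>, and choose \<open>p\<close> and \<open>q\<close> of least degrees. If \<open>deg q \<le> deg p\<close>, then \<open>q\<close>
  cancels the top term of \<open>p\<close>. Otherwise \<open>t p(x) = 1\<close>, solved for its constant terms, writes \<open>1\<close> as
  \<open>x\<close> times a polynomial in \<open>x\<close> of degree below \<open>deg q - 1\<close>. With it the constant term of \<open>q\<close>
  can be replaced by a multiple of \<open>x\<close>, and division by \<open>x\<close> gives a monic equation of smaller degree.
  This is the argument that shows that maximal dominating local rings are valuation rings.
\<close>

lemma maximal_avoiding_integrally_closed:
  fixes w :: "'a::field"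
  assumes A: "is_subring A" and wA: "w \<notin> A" and tA: "inverse w \<in> A"
    and max: "\<And>S. is_subring S \<Longrightarrow> A \<subseteq> S \<Longrightarrow> w \<notin> S \<Longrightarrow> S = A"
  shows "integral_closure A \<subseteq> A"
proof (rule ccontr)
  assume "\<not> integral_closure A \<subseteq> A"
  then obtain x where x: "x \<in> integral_closure A" "x \<notin> A"
    by blast
  define t where "t = inverse w"
  have w0: "w \<noteq> 0" and x0: "x \<noteq> 0"
    using wA x(2) subring_zero[OF A] by auto
  have tw: "t * w = 1" "t \<noteq> 0"
    using w0 by (simp_all add: t_def)
  note P = is_subring_polys_over[OF A]
  have w_mem: "w \<in> poly_values A y" if "y \<notin> A" for y
    using max[OF is_subring_poly_values[OF A] subset_poly_values[OF A], of y]
      self_in_poly_values[OF A, of y] that by metis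
  \<comment> \<open>Powers of an element of \<open>1 + t A\<close> stay in \<open>1 + t A\<close>. So if its inverse could be adjoined to
      give \<open>w\<close>, clearing denominators would put \<open>(1 - t c) w = w - c\<close> into \<open>A\<close> for some \<open>c \<in> A\<close>.\<close>
  have unit: "inverse (1 - t * a) \<in> A" and unit0: "1 - t * a \<noteq> 0" if a: "a \<in> A" for a
  proof -
    define s where "s = 1 - t * a"
    show s0: "1 - t * a \<noteq> 0"
    proof
      assume "1 - t * a = 0"
      then have "t * a = t * w"
        by (simp add: tw)
      then have "a = w"
        using tw(2) by simp
      then show False
        using a wA by simp
    qed
    have sA: "s \<in> A"
      unfolding s_def t_def by (intro subring_diff[OF A] subring_one[OF A] subring_mult[OF A] tA a)
    have pow: "\<exists>c\<in>A. s ^ n = 1 - t * c" for n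
    proof (induction n)
      case 0
      show ?case
        using subring_zero[OF A] by (intro bexI[of _ 0]) auto
    next
      case (Suc n)
      then obtain c where c: "c \<in> A" "s ^ n = 1 - t * c"
        by blast
      have "s ^ Suc n = s * (1 - t * c)"
        by (simp add: c(2))
      also have "\<dots> = 1 - t * (a + s * c)"
        by (simp add: s_def algebra_simps)
      finally show ?case
        using a sA c(1) by (blast intro: subring_add[OF A] subring_mult[OF A])
    qed
    show "inverse (1 - t * a) \<in> A"
    proof (rule ccontr)
      assume "inverse (1 - t * a) \<notin> A"
      then have "w \<in> poly_values A (inverse s)"
        unfolding s_def by (rule w_mem)
      then obtain p where p: "p \<in> polys_over A" "w = poly p (inverse s)"
        by (auto simp: poly_values_def)
      have "poly (reflect_poly p) s = s ^ degree p * w"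
        using p(2) s0 by (simp add: poly_reflect_poly_nz s_def)
      moreover have "poly (reflect_poly p) s \<in> A"
        using poly_in_subring[OF A reflect_poly_over[OF A p(1)] sA] .
      ultimately have *: "s ^ degree p * w \<in> A"
        by simp
      obtain c where c: "c \<in> A" "s ^ degree p = 1 - t * c"
        using pow by blast
      have "s ^ degree p * w = w - (t * w) * c"
        unfolding c(2) by (simp add: algebra_simps)
      then have "w = s ^ degree p * w + c"
        by (simp add: tw)
      then show False
        using subring_add[OF A * c(1)] wA by simp
    qed
  qed
  obtain q where q: "q \<in> polys_over A" "lead_coeff q = 1" "poly q x = 0"
    and qmin: "\<And>q'. q' \<in> polys_over A \<Longrightarrow> lead_coeff q' = 1 \<Longrightarrow> poly q' x = 0 \<Longrightarrow> degree q \<le> degree q'"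
  proof -
    let ?P = "\<lambda>q. q \<in> polys_over A \<and> lead_coeff q = 1 \<and> poly q x = 0"
    have "\<exists>q. ?P q"
      using x(1) by (auto simp: integral_closure_altdef)
    then obtain q where "?P q" "\<forall>q'. ?P q' \<longrightarrow> degree q \<le> degree q'"
      using ex_has_least_nat[of ?P _ degree] by blast
    then show thesis
      by (intro that) blast+
  qed
  obtain p where p: "p \<in> polys_over A" "poly p x = w"
    and pmin: "\<And>p'. p' \<in> polys_over A \<Longrightarrow> poly p' x = w \<Longrightarrow> degree p \<le> degree p'"
  proof -
    let ?P = "\<lambda>p. p \<in> polys_over A \<and> poly p x = w"
    have "\<exists>p. ?P p"
      using w_mem[OF x(2)] by (auto simp: poly_values_def)
    then obtain p where "?P p" "\<forall>p'. ?P p' \<longrightarrow> degree p \<le> degree p'"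
      using ex_has_least_nat[of ?P _ degree] by blast
    then show thesis
      by (intro that) blast+
  qed
  have dq: "degree q > 0"
  proof (rule ccontr)
    assume "\<not> degree q > 0"
    then have "q = [:1:]"
      using q(2) by (metis degree_0_id coeff_pCons_0 degree_eq_zeroE neq0_conv)
    then show False
      using q(3) by simp
  qed
  show False
  proof (cases "degree p < degree q")
    case False
    \<comment> \<open>subtract the multiple of \<open>q\<close> with the same leading term as \<open>p\<close>\<close>
    define k where "k = degree p - degree q"
    define m where "m = monom (lead_coeff p) k"
    define p' where "p' = p - m * q"
    have "m \<in> polys_over A"
      using p(1) by (auto simp: polys_over_def m_def subring_zero[OF A])
    then have "p' \<in> polys_over A"
      unfolding p'_def by (intro subring_diff[OF P] subring_mult[OF P] p q)
    moreover have "poly p' x = w"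
      using p q by (simp add: p'_def)
    ultimately have le: "degree p \<le> degree p'"
      by (rule pmin)
    have p0: "p \<noteq> 0" using False dq by auto
    have dm: "degree (m * q) = degree p" and cm: "coeff (m * q) (degree p) = lead_coeff p"
    proof -
      have nz: "m \<noteq> 0" "q \<noteq> 0" using p0 q(2) by (auto simp: m_def)
      show d: "degree (m * q) = degree p"
        using False nz p0 by (simp add: degree_mult_eq m_def degree_monom_eq k_def)
      have "coeff (m * q) (degree p) = lead_coeff (m * q)" by (simp add: d)
      also have "\<dots> = lead_coeff p"
        using q(2) p0 by (simp add: lead_coeff_mult m_def degree_monom_eq)
      finally show "coeff (m * q) (degree p) = lead_coeff p" .
    qed
    have "degree p' \<le> degree p"
      unfolding p'_def by (rule degree_diff_le) (simp_all add: dm)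
    with le have "degree p' = degree p"
      by simp
    then have "lead_coeff p' = 0"
      by (simp add: p'_def cm)
    then have "p' = 0"
      by (rule iffD1[OF leading_coeff_0_iff])
    then show False
      using \<open>degree p' = degree p\<close> False dq by simp
  next
    case True
    obtain a p' where p': "p = pCons a p'"
      by (cases p) auto
    obtain b q' where q': "q = pCons b q'"
      by (cases q) auto
    have mem: "a \<in> A" "p' \<in> polys_over A" "b \<in> A" "q' \<in> polys_over A"
      using p(1) q(1) by (auto simp: p' q' pCons_over_iff)
    \<comment> \<open>With \<open>p = a + X p'\<close> and \<open>q = b + X q'\<close>, the equation \<open>t p(x) = 1\<close> reads
        \<open>t x p'(x) = 1 - t a\<close>, so that \<open>b = x c p'(x)\<close>.\<close>
    define c where "c = b * (t * inverse (1 - t * a))"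
    have cA: "c \<in> A"
      unfolding c_def using tA by (intro subring_mult[OF A] mem unit) (simp add: t_def)
    define r where "r = q' + smult c p'"
    have "[:c:] * p' \<in> polys_over A"
      by (intro subring_mult[OF P] polys_over_const[OF A] cA mem)
    then have rA: "r \<in> polys_over A"
      unfolding r_def by (intro subring_add[OF P] mem) simp
    have "x * poly p' x = w - a"
      using p(2) by (simp add: p' algebra_simps)
    then have "t * (x * poly p' x) = t * (w - a)"
      by simp
    also have "\<dots> = 1 - t * a"
      by (simp add: right_diff_distrib tw)
    finally have txp: "t * (x * poly p' x) = 1 - t * a" .
    have "x * (c * poly p' x) = b * (inverse (1 - t * a) * (t * (x * poly p' x)))"
      by (simp add: c_def mult_ac)
    also have "\<dots> = b"
      using unit0[OF mem(1)] by (simp add: txp)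
    finally have "x * (c * poly p' x) = b" .
    moreover have "b + x * poly q' x = 0"
      using q(3) by (simp add: q')
    ultimately have "x * poly r x = 0"
      by (simp add: r_def algebra_simps)
    then have rx: "poly r x = 0"
      using x0 by simp
    have q'0: "q' \<noteq> 0"
      using dq by (auto simp: q')
    then have dq': "degree q = Suc (degree q')" "lead_coeff q' = 1"
      using q(2) by (simp_all add: q')
    have r: "degree r = degree q' \<and> lead_coeff r = 1"
    proof (cases "p' = 0")
      case True
      then show ?thesis
        using dq' by (simp add: r_def)
    next
      case p'0: False
      then have less: "degree (smult c p') < degree q'"
        using True by (intro le_less_trans[OF degree_smult_le]) (simp add: p' dq')
      have "degree r = degree q'"
        unfolding r_def by (rule degree_add_eq_left[OF less])
      moreover have "coeff r (degree q') = lead_coeff q'"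
        unfolding r_def coeff_add coeff_eq_0[OF less] by simp
      ultimately show ?thesis
        using dq'(2) by simp
    qed
    then have "degree q \<le> degree r"
      using qmin rA rx by blast
    then show False
      using r dq'(1) by simp
  qed
qed

text \<open>
  A nonintegral \<open>z\<close> is separated from the integral closure by an integrally closed subring, namely a
  maximal one containing \<open>R[1/z]\<close> but not \<open>z\<close>. So whatever lies in all subrings that contain the integral
  closure, such as a difference or a product of two of its elements, lies in it.
\<close>

theorem is_subring_integral_closure:
  fixes R :: "'a::field set"
  assumes R: "is_subring R"
  shows "is_subring (integral_closure R)"
proof -
  have closed: "z \<in> integral_closure R"
    if gen: "\<And>A. is_subring A \<Longrightarrow> integral_closure R \<subseteq> A \<Longrightarrow> z \<in> A" for z
  proof (rule ccontr)
    assume z: "z \<notin> integral_closure R"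
    then have "z \<noteq> 0"
      using subset_integral_closure[OF R] subring_zero[OF R] by auto
    then have "z \<notin> poly_values R (inverse z)"
      using z integral_iff_mem_poly_values_inverse[OF R] by blast
    then obtain A where A: "is_subring A" "poly_values R (inverse z) \<subseteq> A" "z \<notin> A"
      "\<And>S. is_subring S \<Longrightarrow> A \<subseteq> S \<Longrightarrow> z \<notin> S \<Longrightarrow> S = A"
      using maximal_subring_avoiding[OF is_subring_poly_values[OF R]] by metis
    have "inverse z \<in> A" "R \<subseteq> A"
      using A(2) self_in_poly_values[OF R] subset_poly_values[OF R] by blast+
    then have "integral_closure R \<subseteq> A"
      using maximal_avoiding_integrally_closed[OF A(1,3) _ A(4)] integral_closure_mono by blast
    then show False
      using gen A(1,3) by blast
  qed
  show ?thesis
    unfolding is_subring_def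
  proof (intro conjI ballI)
    show "1 \<in> integral_closure R"
      by (rule closed) (rule subring_one)
    fix x y assume "x \<in> integral_closure R" "y \<in> integral_closure R"
    then show "x - y \<in> integral_closure R" "x * y \<in> integral_closure R"
      by (blast intro: closed subring_diff subring_mult)+
  qed
qed

section \<open>Algebraic numbers\<close>

lemma is_subring_Rats: "is_subring (\<rat> :: 'a::field_char_0 set)"
  by (auto simp: is_subring_def)

lemma algebraic_iff_integral_Rats:
  fixes x :: "'a::field_char_0"
  shows "algebraic x \<longleftrightarrow> x \<in> integral_closure \<rat>"
proof
  assume "algebraic x"
  then obtain p where p: "\<And>i. coeff p i \<in> \<rat>" "p \<noteq> 0" "poly p x = 0"
    by (auto simp: algebraic_altdef)
  then show "x \<in> integral_closure \<rat>"
    unfolding integral_closure_def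
    by (intro CollectI exI[of _ "smult (inverse (lead_coeff p)) p"]) simp
next
  assume "x \<in> integral_closure \<rat>"
  then show "algebraic x"
    unfolding integral_closure_def algebraic_altdef by force
qed

lemma is_subring_algebraic: "is_subring {x :: 'a::field_char_0. algebraic x}"
  by (simp add: algebraic_iff_integral_Rats is_subring_integral_closure is_subring_Rats)

lemma algebraic_diff:
  "algebraic x \<Longrightarrow> algebraic y \<Longrightarrow> algebraic (x - y :: 'a::field_char_0)"
  using subring_diff[OF is_subring_algebraic] by blast

lemma algebraic_mult:
  "algebraic x \<Longrightarrow> algebraic y \<Longrightarrow> algebraic (x * y :: 'a::field_char_0)"
  using subring_mult[OF is_subring_algebraic] by blast

section \<open>Leading coefficients\<close>

text \<open>
  A nonzero algebraic number has an algebraic inverse and so is a unit of \<open>S\<close>; a unit of the form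
  \<open>t y\<close> with \<open>y \<in> S\<close> would put \<open>1/t\<close> into \<open>S\<close>.
\<close>

lemma algebraic_in_ideal_eq_zero:
  fixes t c y :: "'a::field_char_0"
  assumes S: "is_subring S" and algS: "{c. algebraic c} \<subseteq> S" and t: "inverse t \<notin> S"
    and c: "algebraic c" "c = t * y" "y \<in> S"
  shows "c = 0"
proof (rule ccontr)
  assume "c \<noteq> 0"
  then have "inverse t = inverse c * y"
    using c(2) by (simp add: field_simps)
  moreover have "inverse c * y \<in> S"
    using c algS by (intro subring_mult[OF S]) auto
  ultimately show False
    using t by simp
qed

text \<open>
  After cancelling the smaller power of \<open>t\<close>, an algebraic number remains that lies in \<open>t S\<close>: if
  the exponents differ, the leading coefficient next to the smaller one, and \<open>a - b\<close> if they agree.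
\<close>

lemma leading_coefficient_unique:
  fixes t a b y z :: "'a::field_char_0" and m n :: int
  assumes S: "is_subring S" and algS: "{c. algebraic c} \<subseteq> S"
    and t: "t \<in> S" "inverse t \<notin> S"
    and ab: "algebraic a" "algebraic b" "a \<noteq> 0" "b \<noteq> 0" and yz: "y \<in> S" "z \<in> S"
    and eq: "t powi m * (a + t * y) = t powi n * (b + t * z)"
  shows "a = b"
proof -
  have t0: "t \<noteq> 0"
    using t subring_zero[OF S] by auto
  note key = algebraic_in_ideal_eq_zero[OF S algS t(2)]
  have mem: "c \<in> S" if "algebraic c" for c
    using that algS by blast
  have less: False
    if lt: "i < j" and e: "t powi i * (d + t * u) = t powi j * (e + t * v)"
      and d: "algebraic d" "algebraic e" "d \<noteq> 0" "u \<in> S" "v \<in> S"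
    for i j :: int and d e u v
  proof -
    define k where "k = nat (j - i - 1)"
    have "t powi j = t powi (i + 1 + int k)"
      using lt by (simp add: k_def)
    also have "\<dots> = t powi i * (t * t ^ k)"
      using t0 by (simp add: power_int_add mult.assoc)
    finally have "d + t * u = t * t ^ k * (e + t * v)"
      using e t0 by simp
    then have "d = t * (t ^ k * (e + t * v) - u)"
      by (simp add: algebra_simps)
    then have "d = 0"
      by (rule key[OF d(1)]) (intro subring_diff[OF S] subring_mult[OF S] subring_power[OF S]
          subring_add[OF S] t mem d)
    then show False
      using d by simp
  qed
  have "m = n"
    using less[OF _ eq] less[OF _ eq[symmetric]] ab yz by (meson linorder_neqE)
  then have "a + t * y = b + t * z"
    using eq t0 by simp
  then have "a - b = t * (z - y)"
    by (simp add: algebra_simps)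
  then have "a - b = 0"
    by (rule key[OF algebraic_diff[OF ab(1,2)]]) (intro subring_diff[OF S] yz)
  then show ?thesis
    by simp
qed

section \<open>The local ring and its integral closure\<close>

lemma is_subfield_adjoin: "is_subfield (adjoin K S)"
  unfolding adjoin_def by (rule hull_in) (auto simp: is_subfield_def)

lemma subset_adjoin: "K \<subseteq> adjoin K S"
  unfolding adjoin_def by (metis hull_subset le_sup_iff)

lemma is_subfield_imp_is_subring: "is_subfield k \<Longrightarrow> is_subring k"
  by (auto simp: is_subfield_def is_subring_def)

lemma algebraic_over_inverse:
  assumes "is_subring k" "algebraic_over k (inverse x)"
  shows "algebraic_over k (x :: 'a::field)"
proof (cases "x = 0")
  case True
  have "coeff [:0, 1:] i \<in> k" for i :: nat
    using polys_over_X[OF assms(1)] by (simp add: polys_over_def)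
  then show ?thesis
    unfolding algebraic_over_def True by (intro exI[of _ "[:0, 1:]"]) auto
next
  case False
  obtain p where p: "p \<in> polys_over k" "p \<noteq> 0" "poly p (inverse x) = 0"
    using assms(2) by (auto simp: algebraic_over_def polys_over_def)
  then have "poly (reflect_poly p) x = 0"
    using False by (simp add: poly_reflect_poly_nz)
  then show ?thesis
    using reflect_poly_over[OF assms(1) p(1)] p(2)
    unfolding algebraic_over_def polys_over_def by auto
qed

context
  fixes k :: "'a::field set" and t :: 'a
  assumes k: "is_subring k" and t: "\<not> algebraic_over k t"
begin

lemma poly_transcendental_nonzero: "p \<in> polys_over k \<Longrightarrow> p \<noteq> 0 \<Longrightarrow> poly p t \<noteq> 0"
  using t by (auto simp: algebraic_over_def polys_over_def)

lemma local_ringI: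
  "f \<in> polys_over k \<Longrightarrow> g \<in> polys_over k \<Longrightarrow> poly g 0 \<noteq> 0 \<Longrightarrow> x = poly f t / poly g t
    \<Longrightarrow> x \<in> local_ring k t"
  by (auto simp: local_ring_def polys_over_def)

lemma poly_in_local_ring: "p \<in> polys_over k \<Longrightarrow> poly p t \<in> local_ring k t"
  by (rule local_ringI[of p 1]) (auto intro: subring_one[OF is_subring_polys_over[OF k]])

lemma local_ringE:
  assumes "x \<in> local_ring k t"
  obtains f g where "f \<in> polys_over k" "g \<in> polys_over k" "poly g 0 \<noteq> 0" "poly g t \<noteq> 0"
    "x = poly f t / poly g t"
proof -
  obtain f g where *: "f \<in> polys_over k" "g \<in> polys_over k" "poly g 0 \<noteq> 0" "x = poly f t / poly g t"
    using assms by (auto simp: local_ring_def polys_over_def)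
  moreover have "poly g t \<noteq> 0"
    using * by (intro poly_transcendental_nonzero) auto
  ultimately show thesis
    by (intro that)
qed

lemma is_subring_local_ring: "is_subring (local_ring k t)"
  unfolding is_subring_def
proof (intro conjI ballI)
  note P = is_subring_polys_over[OF k]
  show "1 \<in> local_ring k t"
    using poly_in_local_ring[OF subring_one[OF P]] by simp
  fix x y assume xy: "x \<in> local_ring k t" "y \<in> local_ring k t"
  obtain f g where x: "f \<in> polys_over k" "g \<in> polys_over k" "poly g 0 \<noteq> 0" "poly g t \<noteq> 0"
    "x = poly f t / poly g t"
    using xy(1) by (rule local_ringE)
  obtain f' g' where y: "f' \<in> polys_over k" "g' \<in> polys_over k" "poly g' 0 \<noteq> 0" "poly g' t \<noteq> 0"
    "y = poly f' t / poly g' t"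
    using xy(2) by (rule local_ringE)
  show "x - y \<in> local_ring k t"
    by (rule local_ringI[of "f * g' - f' * g" "g * g'"])
      (use x y in \<open>auto intro!: subring_diff[OF P] subring_mult[OF P] simp: diff_frac_eq\<close>)
  show "x * y \<in> local_ring k t"
    by (rule local_ringI[of "f * f'" "g * g'"])
      (use x y in \<open>auto intro!: subring_mult[OF P]\<close>)
qed

text \<open>If \<open>1/t = f(t)/g(t)\<close>, then \<open>g - X f\<close> vanishes at \<open>t\<close>, so it is zero, and \<open>g(0) = 0\<close>.\<close>

lemma inverse_notin_local_ring: "inverse t \<notin> local_ring k t"
proof
  assume "inverse t \<in> local_ring k t"
  then obtain f g where fg: "f \<in> polys_over k" "g \<in> polys_over k" "poly g 0 \<noteq> 0" "poly g t \<noteq> 0"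
    "inverse t = poly f t / poly g t"
    by (rule local_ringE)
  have t0: "t \<noteq> 0"
    using poly_transcendental_nonzero[OF polys_over_X[OF k]] by auto
  define h where "h = g - [:0, 1:] * f"
  have "h \<in> polys_over k"
    unfolding h_def by (intro subring_diff subring_mult is_subring_polys_over k fg polys_over_X)
  moreover have "poly h t = 0"
    using fg t0 by (simp add: h_def field_simps)
  moreover have "poly h 0 \<noteq> 0"
    using fg by (simp add: h_def)
  ultimately show False
    using poly_transcendental_nonzero by force
qed

end

lemma inverse_not_integral:
  fixes t :: "'a::field"
  assumes R: "is_subring R" and t: "t \<in> R" "inverse t \<notin> R"
  shows "inverse t \<notin> integral_closure R"
proof
  assume "inverse t \<in> integral_closure R"
  moreover have "inverse t \<noteq> 0"
    using t(2) subring_zero[OF R] by auto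
  ultimately have "inverse t \<in> poly_values R t"
    using integral_iff_mem_poly_values_inverse[OF R, of "inverse t"] by simp
  then show False
    using t poly_in_subring[OF R] by (auto simp: poly_values_def)
qed

text \<open>
  These are the facts about \<open>O\<close> that make leading coefficients well defined. Transcendence of \<open>T\<close> over
  \<open>k\<close> keeps \<open>1/t = T\<close> out of the local ring, and the integral closure does not bring it back.
\<close>

lemma O_ring_properties:
  fixes k :: "real set" and T :: real
  assumes k: "is_subfield k" "\<rat> \<subseteq> k" and T: "T \<in> transcendentals k"
  defines "t \<equiv> complex_of_real (inverse T)"
  shows "is_subring (O_ring k T)" "{c. algebraic c} \<subseteq> O_ring k T"
    "t \<in> O_ring k T" "inverse t \<notin> O_ring k T"
proof -
  note kr = is_subfield_imp_is_subring[OF k(1)]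
  have trans: "\<not> algebraic_over k (inverse T)"
    using T algebraic_over_inverse[OF kr] by (auto simp: transcendentals_def)
  define L where "L = local_ring k (inverse T)"
  have L: "is_subring L" "inverse T \<in> L" "inverse (inverse T) \<notin> L"
    unfolding L_def
    using is_subring_local_ring[OF kr trans] inverse_notin_local_ring[OF kr trans]
      poly_in_local_ring[OF kr trans polys_over_X[OF kr]] by auto
  define R where "R = complex_of_real ` L"
  have R: "is_subring R"
    unfolding R_def by (rule is_subring_image[OF L(1)]) auto
  have tR: "t \<in> R" "inverse t \<notin> R"
    using L(2,3) by (auto simp: R_def t_def simp flip: of_real_inverse)
  have O: "O_ring k T = integral_closure R"
    by (simp add: O_ring_def R_def L_def)
  show "is_subring (O_ring k T)"
    unfolding O by (rule is_subring_integral_closure[OF R])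
  show "t \<in> O_ring k T"
    unfolding O using subset_integral_closure[OF R] tR(1) by blast
  show "inverse t \<notin> O_ring k T"
    unfolding O by (rule inverse_not_integral[OF R tR])
  have "\<rat> \<subseteq> R"
  proof
    fix q :: complex assume "q \<in> \<rat>"
    then obtain i j where "q = of_int i / of_int j"
      by (rule Rats_cases')
    then have "q = complex_of_real (of_int i / of_int j)"
      by simp
    then obtain r where r: "q = complex_of_real r" "r \<in> \<rat>"
      by (rule that) auto
    have "poly [:r:] (inverse T) \<in> L"
      unfolding L_def using k(2) r(2) by (intro poly_in_local_ring kr trans polys_over_const) auto
    then show "q \<in> R"
      by (simp add: R_def r)
  qed
  then show "{c. algebraic c} \<subseteq> O_ring k T"
    unfolding O algebraic_iff_integral_Rats using integral_closure_mono by blast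
qed

section \<open>The cone\<close>

theorem proposition2p7:
  fixes B k :: "real set" and T :: real
  assumes "transcendence_basis \<rat> B"
    and "pi \<in> B"
    and "k = adjoin \<rat> (B - {pi})"
    and "T \<in> transcendentals k"
  shows "\<not> (\<exists>u. is_lub (cone_order (pos_cone k T)) u {0, \<i>})"
proof
  assume "\<exists>u. is_lub (cone_order (pos_cone k T)) u {0, \<i>}"
  then obtain u where u: "u \<in> pos_cone k T" "u - \<i> \<in> pos_cone k T"
    and least: "\<And>w. w \<in> pos_cone k T \<Longrightarrow> w - \<i> \<in> pos_cone k T \<Longrightarrow> w - u \<in> pos_cone k T"
    by (auto simp: least_def Upper_def cone_order_def)
  define t where "t = complex_of_real (inverse T)"
  define S where "S = O_ring k T"
  have k: "is_subfield k" "\<rat> \<subseteq> k"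
    using assms(3) is_subfield_adjoin subset_adjoin by blast+
  note props = O_ring_properties[OF k assms(4), folded t_def S_def]
  note S = props(1) and algS = props(2) and t = props(3,4)
  have alg: "c \<in> S" if "algebraic c" for c
    using that algS by blast
  have t0: "t \<noteq> 0"
    using t subring_zero[OF S] by auto
  have cone: "x \<in> pos_cone k T \<longleftrightarrow> x = 0 \<or>
      (\<exists>n a y. algebraic a \<and> a > 0 \<and> y \<in> S \<and> x = t powi n * (complex_of_real a + t * y))" for x
  proof -
    have neg: "(\<exists>n::int. Q (- n)) \<longleftrightarrow> (\<exists>n. Q n)" for Q
      by (metis minus_minus)
    have "pos_cone k T = {0} \<union> (\<Union>n::int. {t powi (- n) * (complex_of_real a + t * y) | a y.
        algebraic a \<and> a > 0 \<and> y \<in> S})"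
      by (simp only: pos_cone_def t_def S_def Let_def)
    then have "x \<in> pos_cone k T \<longleftrightarrow> x = 0 \<or> (\<exists>n. \<exists>a y. algebraic a \<and> a > 0 \<and> y \<in> S \<and>
        x = t powi (- n) * (complex_of_real a + t * y))"
      by blast
    then show ?thesis
      by (subst (asm) neg)
  qed
  have not_cone: "t powi n * (c + t * y) \<notin> pos_cone k T"
    if c: "algebraic c" "\<nexists>a. a > 0 \<and> c = complex_of_real a" "c \<noteq> 0" and y: "y \<in> S" for n c y
  proof
    assume "t powi n * (c + t * y) \<in> pos_cone k T"
    then consider "t powi n * (c + t * y) = 0" |
      m a z where "algebraic a" "a > 0" "z \<in> S"
        "t powi n * (c + t * y) = t powi m * (complex_of_real a + t * z)"
      unfolding cone by blast
    then show False
    proof cases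
      case 1
      then have "c = t * (- y)"
        using t0 by (simp add: add_eq_0_iff)
      then show False
        using algebraic_in_ideal_eq_zero[OF S algS t(2) c(1) _ subring_minus[OF S y]] c(3) by blast
    next
      case 2
      then have "c = complex_of_real a"
        using leading_coefficient_unique[OF S algS t c(1) _ c(3) _ y 2(3,4)] by simp
      then show False
        using c(2) 2(2) by blast
    qed
  qed
  have i: "algebraic \<i>" "\<i> \<in> S"
    using alg by auto
  \<comment> \<open>An upper bound is infinitely large: otherwise its difference to \<open>\<i>\<close> has a leading coefficient
      with imaginary part \<open>-1\<close>.\<close>
  have no_expansion: False
    if b: "algebraic b" and y: "y \<in> S" and u_eq: "u = complex_of_real b + t * y" for b y
  proof -
    have "t powi 0 * ((complex_of_real b - \<i>) + t * y) \<notin> pos_cone k T"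
    proof (rule not_cone[OF _ _ _ y])
      show "algebraic (complex_of_real b - \<i>)"
        using b by (intro algebraic_diff) auto
      show "\<nexists>a. a > 0 \<and> complex_of_real b - \<i> = complex_of_real a" "complex_of_real b - \<i> \<noteq> 0"
        by (auto simp: complex_eq_iff)
    qed
    then show False
      using u(2) by (simp add: u_eq algebra_simps)
  qed
  have "u \<noteq> 0"
    using no_expansion[of 0 0] subring_zero[OF S] by auto
  then obtain n a y where a: "algebraic a" "a > 0" and y: "y \<in> S"
    and u_eq: "u = t powi n * (complex_of_real a + t * y)"
    using u(1) cone by auto
  show False
  proof (cases "n \<ge> 0")
    case True
    define m where "m = nat n"
    have u_eq': "u = t ^ m * (complex_of_real a + t * y)"
      using True by (simp add: u_eq m_def power_int_def)
    show False
    proof (cases m)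
      case 0
      then show False
        using no_expansion[OF a(1) y] u_eq' by simp
    next
      case (Suc l)
      have "t ^ l * (complex_of_real a + t * y) \<in> S"
        using a by (intro subring_mult[OF S] subring_power[OF S] subring_add[OF S] t y alg) auto
      moreover have "u = complex_of_real 0 + t * (t ^ l * (complex_of_real a + t * y))"
        by (simp add: u_eq' Suc)
      ultimately show False
        using no_expansion[OF algebraic_0] by blast
    qed
  next
    case False
    \<comment> \<open>The competing upper bound has exponent \<open>-1\<close>, the smallest order of magnitude that works. The
        factor \<open>1/2\<close> matters only if \<open>u\<close> has this exponent too.\<close>
    define h where "h = a / 2"
    have h: "algebraic h" "h > 0"
      using algebraic_mult[OF a(1), of "1 / 2"] a rat_imp_algebraic[of "1 / 2 :: real"]
      by (auto simp: h_def)
    define w where "w = t powi (- 1) * complex_of_real h"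
    have "w \<in> pos_cone k T"
      unfolding cone w_def using h subring_zero[OF S]
      by (intro disjI2 exI[of _ "- 1"] exI[of _ h] exI[of _ 0]) auto
    moreover have "w - \<i> = t powi (- 1) * (complex_of_real h + t * (- \<i>))"
      using t0 by (simp add: w_def power_int_minus field_simps)
    then have "w - \<i> \<in> pos_cone k T"
      unfolding cone using h subring_minus[OF S i(2)] by blast
    ultimately have "w - u \<in> pos_cone k T"
      by (rule least)
    moreover have "w - u \<notin> pos_cone k T"
    proof (cases "n = - 1")
      case True
      have "w - u = t powi (- 1) * (complex_of_real (- h) + t * (- y))"
        by (simp add: w_def u_eq True h_def algebra_simps)
      moreover have "\<dots> \<notin> pos_cone k T"
        by (rule not_cone[OF _ _ _ subring_minus[OF S y]]) (use h in auto)
      ultimately show ?thesis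
        by simp
    next
      case n: False
      \<comment> \<open>Here \<open>n \<le> -2\<close>, so \<open>w\<close> only contributes to the part of \<open>w - u\<close> behind its leading term.\<close>
      define l where "l = nat (- 2 - n)"
      have "(- 1 :: int) = n + 1 + int l"
        using False n by (simp add: l_def)
      then have "t powi (- 1) = t powi (n + 1 + int l)"
        by (simp only:)
      also have "\<dots> = t powi n * (t * t ^ l)"
        using t0 by (simp add: power_int_add mult.assoc)
      finally have "w - u = t powi n * (complex_of_real (- a) + t * (t ^ l * complex_of_real h - y))"
        by (simp add: w_def u_eq algebra_simps)
      moreover have "t ^ l * complex_of_real h - y \<in> S"
        using h by (intro subring_diff[OF S] subring_mult[OF S] subring_power[OF S] t y alg) auto
      then have "t powi n * (complex_of_real (- a) + t * (t ^ l * complex_of_real h - y))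
          \<notin> pos_cone k T"
        by (rule not_cone[rotated 3]) (use a in auto)
      ultimately show ?thesis
        by simp
    qed
    ultimately show False
      by blast
  qed
qed

end
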